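(* Let $n\ge 1$ and $l\ge 1$ be integers, and let $\mathbb{V}$ be an $l$-dimensional vector space over a field $\mathbb{F}$. Let $E_1,\ldots,E_n$ be subsets of $\mathbb{V}$ such that $E_i\subseteq \mathbb{W}_i$ for all $i=1,\ldots,n$, where each $\mathbb{W}_i$ is a one-dimensional subspace of $\mathbb{V}$. Let $S=\{1,\ldots,n\}$ and let $\mathcal{I}$ be the set of subsets $I=\{i_1,\ldots,i_j\}$ of $S$ for which $\{E_{i_1},E_{i_2},\ldots,E_{i_j}\}$ forms a LISF. Then the ordered pair $(S,\mathcal{I})$ is a matroid.
   Context: LISF: Let $\mathbb{V}$ be an $l$-dimensional vector space over a field $\mathbb{F}$. A family $\{C_i : i=1,\ldots,n\}$ ($n\le l$) of non-empty subsets $C_i\subseteq\mathbb{V}$ is called a linearly independent set family (LISF) if every selection of $n$ vectors $v_i\in C_i$ ($i=1,\ldots,n$) is linearly independent in $\mathbb{V}$. Families are understood as indexed by their labels: sets with different labels count as different members even if they are equal as sets, and the vectors $v_1,\ldots,v_n$ are linearly independent as an indexed family. The empty family is regarded as a LISF. Matroid: a pair $(S,\mathcal{I})$ with $S$ a finite set and $\mathcal{I}$ a collection of subsets of $S$ such that (I.1) $\emptyset\in\mathcal{I}$; (I.2) if $I\in\mathcal{I}$ and $I'\subseteq I$ then $I'\in\mathcal{I}$; (I.3) if $I_1,I_2\in\mathcal{I}$ and $|I_1|<|I_2|$ then there is $e\in I_2\setminus I_1$ with $I_1\cup\{e\}\in\mathcal{I}$. *)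

theory Defs
  imports Main "HOL.Vector_Spaces"
begin

context vector_space
begin

text \<open>
  Linear independence of an indexed family (as opposed to the library's \<^const>\<open>dependent\<close>,
  which speaks about a set of vectors): a repeated vector makes the family dependent.
\<close>

definition lin_indep_family :: "'i set \<Rightarrow> ('i \<Rightarrow> 'b) \<Rightarrow> bool" where
  "lin_indep_family J v \<longleftrightarrow>
     finite J \<and> (\<forall>c. (\<Sum>i\<in>J. c i *s v i) = 0 \<longrightarrow> (\<forall>i\<in>J. c i = 0))"

lemma lin_indep_family_iff:
  "lin_indep_family J v \<longleftrightarrow> finite J \<and> inj_on v J \<and> independent (v ` J)"
proof (cases "finite J")
  case fin: True
  show ?thesis
  proof
    assume indep: "lin_indep_family J v"
    have inj: "inj_on v J"
    proof (rule inj_onI, rule ccontr)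
      fix i j assume ij: "i \<in> J" "j \<in> J" "v i = v j" "i \<noteq> j"
      let ?c = "\<lambda>k. if k = i then 1 else if k = j then - 1 else (0::'a)"
      have "(\<Sum>k\<in>J. ?c k *s v k) = (\<Sum>k\<in>{i, j}. ?c k *s v k)"
        using fin ij by (intro sum.mono_neutral_right) auto
      also have "\<dots> = 0" using ij by simp
      finally have "\<forall>k\<in>J. ?c k = 0"
        using indep[unfolded lin_indep_family_def, THEN conjunct2, rule_format, of ?c]
        by simp
      then show False using ij(1) by auto
    qed
    have "u x = 0" if "(\<Sum>x\<in>v ` J. u x *s x) = 0" "x \<in> v ` J" for u x
    proof -
      have "(\<Sum>i\<in>J. u (v i) *s v i) = 0"
        using that(1) by (simp add: sum.reindex[OF inj])
      then have "\<forall>i\<in>J. u (v i) = 0"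
        using indep[unfolded lin_indep_family_def, THEN conjunct2, rule_format,
            of "\<lambda>i. u (v i)"] by blast
      then show ?thesis using that(2) by auto
    qed
    then have "independent (v ` J)"
      using fin by (subst dependent_finite) auto
    then show "finite J \<and> inj_on v J \<and> independent (v ` J)"
      using fin inj by blast
  next
    assume R: "finite J \<and> inj_on v J \<and> independent (v ` J)"
    then have inj: "inj_on v J" and ind: "independent (v ` J)" by auto
    have "c i = 0" if sum0: "(\<Sum>i\<in>J. c i *s v i) = 0" and i: "i \<in> J" for c i
    proof -
      let ?u = "\<lambda>x. c (the_inv_into J v x)"
      have "(\<Sum>x\<in>v ` J. ?u x *s x) = (\<Sum>i\<in>J. c i *s v i)"
        unfolding sum.reindex[OF inj] o_def
        by (intro sum.cong) (auto simp: the_inv_into_f_f[OF inj])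
      then have "?u (v i) = 0"
        using ind fin i sum0 dependent_finite[of "v ` J"] by auto
      then show ?thesis by (simp add: the_inv_into_f_f[OF inj i])
    qed
    then show "lin_indep_family J v"
      using fin unfolding lin_indep_family_def by blast
  qed
qed (simp add: lin_indep_family_def)

text \<open>
  Linearly independent set families, labelled by \<open>J\<close>; meant for finite-dimensional spaces
  (\<^term>\<open>dim UNIV\<close> is 0 by convention when there is no finite basis).
  Only the labels in \<open>J\<close> matter, and the empty family is a LISF.
\<close>

definition LISF :: "'i set \<Rightarrow> ('i \<Rightarrow> 'b set) \<Rightarrow> bool" where
  "LISF J C \<longleftrightarrow>
     finite J \<and> card J \<le> dim (UNIV :: 'b set) \<and>
     (\<forall>i\<in>J. C i \<noteq> {}) \<and>
     (\<forall>v. (\<forall>i\<in>J. v i \<in> C i) \<longrightarrow> lin_indep_family J v)"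

end

locale matroid =
  fixes S :: "'e set" and \<I> :: "'e set set"
  assumes finite_ground: "finite S"
    and indep_subset_ground: "I \<in> \<I> \<Longrightarrow> I \<subseteq> S"
    and empty_indep: "{} \<in> \<I>"
    and subset_indep: "\<lbrakk>I \<in> \<I>; I' \<subseteq> I\<rbrakk> \<Longrightarrow> I' \<in> \<I>"
    and augment: "\<lbrakk>I1 \<in> \<I>; I2 \<in> \<I>; card I1 < card I2\<rbrakk> \<Longrightarrow> \<exists>e\<in>I2 - I1. I1 \<union> {e} \<in> \<I>"

end

theory Submission
  imports Defs
begin

text \<open>
  Pick a spanning vector \<open>w i\<close> of each line \<open>W i\<close>. Every nonzero element of \<open>E i\<close> is a nonzero
  multiple of \<open>w i\<close>, and nonzero rescaling does not affect linear independence. So a set of labels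
  forms a LISF iff none of its \<open>E i\<close> is empty or contains \<open>0\<close> and the \<open>w i\<close> are independent, and
  the claim reduces to the vector matroid of \<open>w\<close> on the labels with admissible \<open>E i\<close>.
\<close>

context vector_space
begin

lemma lin_indep_family_subset:
  assumes "lin_indep_family J v" and "K \<subseteq> J"
  shows "lin_indep_family K v"
  using assms unfolding lin_indep_family_iff
  by (meson finite_subset inj_on_subset image_mono independent_mono)

text \<open>Coefficients \<open>c i\<close> of a relation among the rescaled vectors become
  coefficients \<open>c i * k i\<close> of a relation among the original ones, and a field has no
  zero divisors.\<close>

lemma lin_indep_family_scale:
  assumes indep: "lin_indep_family J v" and k: "\<And>i. i \<in> J \<Longrightarrow> k i \<noteq> 0"
  shows "lin_indep_family J (\<lambda>i. k i *s v i)"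
  unfolding lin_indep_family_def
proof (intro conjI allI impI)
  show "finite J"
    using indep by (simp add: lin_indep_family_def)
  fix c assume "(\<Sum>i\<in>J. c i *s (k i *s v i)) = 0"
  then have "(\<Sum>i\<in>J. (c i * k i) *s v i) = 0"
    by simp
  then have "\<forall>i\<in>J. c i * k i = 0"
    using indep[unfolded lin_indep_family_def, THEN conjunct2, rule_format, of "\<lambda>i. c i * k i"]
    by blast
  then show "\<forall>i\<in>J. c i = 0"
    using k by auto
qed

lemma lin_indep_family_cong:
  assumes "\<And>i. i \<in> J \<Longrightarrow> v i = w i"
  shows "lin_indep_family J v \<longleftrightarrow> lin_indep_family J w"
  unfolding lin_indep_family_iff
  using inj_on_cong[of J v w] image_cong[of J J v w] assms by auto

lemma lin_indep_family_scale_iff: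
  assumes v: "\<And>i. i \<in> J \<Longrightarrow> v i = k i *s w i" and k: "\<And>i. i \<in> J \<Longrightarrow> k i \<noteq> 0"
  shows "lin_indep_family J v \<longleftrightarrow> lin_indep_family J w"
proof
  assume "lin_indep_family J v"
  then have "lin_indep_family J (\<lambda>i. inverse (k i) *s v i)"
    using k by (intro lin_indep_family_scale) auto
  then show "lin_indep_family J w"
    by (rule lin_indep_family_cong[THEN iffD1, rotated]) (simp add: v k)
next
  assume "lin_indep_family J w"
  then have "lin_indep_family J (\<lambda>i. k i *s w i)"
    using k by (rule lin_indep_family_scale)
  then show "lin_indep_family J v"
    by (rule lin_indep_family_cong[THEN iffD1, rotated]) (simp add: v)
qed

lemma lin_indep_family_nonzero:
  assumes "lin_indep_family J v" and "i \<in> J"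
  shows "v i \<noteq> 0"
  using assms dependent_zero[of "v ` J"] unfolding lin_indep_family_iff by force

lemma lin_indep_family_augment:
  assumes I: "lin_indep_family I v" and J: "lin_indep_family J v" and less: "card I < card J"
  shows "\<exists>e\<in>J - I. lin_indep_family (insert e I) v"
proof -
  have fin: "finite I" "inj_on v I" "independent (v ` I)"
    and J': "inj_on v J" "independent (v ` J)"
    using I J by (auto simp: lin_indep_family_iff)
  have "\<not> v ` J \<subseteq> span (v ` I)"
  proof
    assume "v ` J \<subseteq> span (v ` I)"
    then have "card (v ` J) \<le> card (v ` I)"
      using independent_span_bound fin J' by blast
    then show False
      using less fin J' by (simp add: card_image)
  qed
  then obtain e where e: "e \<in> J" "v e \<notin> span (v ` I)"
    by blast
  \<comment> \<open>This gives both \<open>e \<notin> I\<close> and injectivity of \<open>v\<close>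
    on \<open>insert e I\<close>.\<close>
  then have "v e \<notin> v ` I"
    using span_base by blast
  moreover have "independent (insert (v e) (v ` I))"
    using e fin by (simp add: independent_insert)
  ultimately have "lin_indep_family (insert e I) v"
    using fin unfolding lin_indep_family_iff by auto
  with e \<open>v e \<notin> v ` I\<close> show ?thesis
    by blast
qed

text \<open>Compares the family with a finite basis; it yields the cardinality clause when
  establishing \<open>LISF\<close>.\<close>

lemma card_le_dim_if_lin_indep_family:
  assumes indep: "lin_indep_family J v" and dim: "dim (UNIV :: 'b set) > 0"
  shows "card J \<le> dim (UNIV :: 'b set)"
proof -
  obtain B :: "'b set" where B: "UNIV \<subseteq> span B" "card B = dim (UNIV :: 'b set)"
    using basis_exists[of UNIV] by metis
  \<comment> \<open>An infinite set has \<open>card\<close> 0, so positive dimension forces the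
    basis to be finite.\<close>
  have "finite B"
    using B(2) dim by (metis card_gt_0_iff)
  then have "card (v ` J) \<le> card B"
    using independent_span_bound[of B "v ` J"] indep B(1) by (auto simp: lin_indep_family_iff)
  then show ?thesis
    using indep B(2) by (simp add: lin_indep_family_iff card_image)
qed

lemma dim_1_obtain_generator:
  assumes "dim V = 1"
  obtains w where "V \<subseteq> span {w}"
proof -
  obtain B where "V \<subseteq> span B" "card B = 1"
    using basis_exists[of V] assms by metis
  then show ?thesis
    using that by (auto simp: card_1_singleton_iff)
qed

lemma LISF_lines_iff:
  assumes lines: "\<And>i. i \<in> J \<Longrightarrow> E i \<subseteq> span {w i}" and dim: "dim (UNIV :: 'b set) > 0"
  shows "LISF J E \<longleftrightarrow> (\<forall>i\<in>J. E i \<noteq> {} \<and> 0 \<notin> E i) \<and> lin_indep_family J w"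
proof -
  have rescale: "lin_indep_family J v \<longleftrightarrow> lin_indep_family J w"
    if v: "\<And>i. i \<in> J \<Longrightarrow> v i \<in> E i" "\<And>i. i \<in> J \<Longrightarrow> v i \<noteq> 0" for v
  proof -
    have "\<forall>i\<in>J. \<exists>k. v i = k *s w i"
      using v(1) lines unfolding span_singleton by blast
    then obtain k where k: "\<And>i. i \<in> J \<Longrightarrow> v i = k i *s w i"
      by metis
    \<comment> \<open>A zero factor would make the selected vector \<open>v i\<close> zero.\<close>
    with v(2) have "\<And>i. i \<in> J \<Longrightarrow> k i \<noteq> 0"
      by force
    with k show ?thesis
      by (rule lin_indep_family_scale_iff)
  qed
  show ?thesis
  proof
    assume L: "LISF J E"
    then have "\<forall>i\<in>J. \<exists>x. x \<in> E i"
      unfolding LISF_def by blast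
    then obtain v where v: "\<And>i. i \<in> J \<Longrightarrow> v i \<in> E i"
      by metis
    have sel: "lin_indep_family J u" if "\<And>i. i \<in> J \<Longrightarrow> u i \<in> E i" for u
      using L that unfolding LISF_def by blast
    have "0 \<notin> E i" if i: "i \<in> J" for i
    proof
      assume "0 \<in> E i"
      \<comment> \<open>If \<open>0\<close> were available at label \<open>i\<close>, it could be
        swapped into the selection \<open>v\<close>, producing an independent family with a zero
        entry.\<close>
      then have "lin_indep_family J (v(i := 0))"
        using v by (intro sel) auto
      from lin_indep_family_nonzero[OF this i] show False
        by simp
    qed
    \<comment> \<open>One selection suffices: \<open>v\<close> is independent, hence has nonzero
      entries, so \<open>rescale\<close> carries its independence over to \<open>w\<close>.\<close>
    moreover have "lin_indep_family J w"
      using rescale[of v] sel[of v] lin_indep_family_nonzero[of J v] v by blast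
    ultimately show "(\<forall>i\<in>J. E i \<noteq> {} \<and> 0 \<notin> E i) \<and> lin_indep_family J w"
      using v by blast
  next
    assume R: "(\<forall>i\<in>J. E i \<noteq> {} \<and> 0 \<notin> E i) \<and> lin_indep_family J w"
    then have "lin_indep_family J v" if "\<forall>i\<in>J. v i \<in> E i" for v
      using rescale[of v] that by metis
    with R show "LISF J E"
      unfolding LISF_def
      using card_le_dim_if_lin_indep_family[OF _ dim] lin_indep_family_iff by blast
  qed
qed

text \<open>\<open>P\<close> constrains labels one at a time, so subsets inherit it, and an
  augmenting label satisfies it because it comes from an admissible set.\<close>

lemma matroid_lin_indep_family:
  assumes "finite S"
  shows "matroid S {I. I \<subseteq> S \<and> (\<forall>i\<in>I. P i) \<and> lin_indep_family I w}"
proof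
  show "{} \<in> {I. I \<subseteq> S \<and> (\<forall>i\<in>I. P i) \<and> lin_indep_family I w}"
    by (simp add: lin_indep_family_def)
next
  fix I I' assume "I \<in> {I. I \<subseteq> S \<and> (\<forall>i\<in>I. P i) \<and> lin_indep_family I w}" "I' \<subseteq> I"
  then show "I' \<in> {I. I \<subseteq> S \<and> (\<forall>i\<in>I. P i) \<and> lin_indep_family I w}"
    using lin_indep_family_subset by blast
next
  fix I J assume I: "I \<in> {I. I \<subseteq> S \<and> (\<forall>i\<in>I. P i) \<and> lin_indep_family I w}"
    and J: "J \<in> {I. I \<subseteq> S \<and> (\<forall>i\<in>I. P i) \<and> lin_indep_family I w}" and "card I < card J"
  then obtain e where "e \<in> J - I" "lin_indep_family (insert e I) w"
    using lin_indep_family_augment by blast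
  with I J show "\<exists>e\<in>J - I. I \<union> {e} \<in> {I. I \<subseteq> S \<and> (\<forall>i\<in>I. P i) \<and> lin_indep_family I w}"
    by (intro bexI[of _ e]) auto
qed (use assms in auto)

end

theorem theorem3p1:
  fixes scale :: "'a::field \<Rightarrow> 'b::ab_group_add \<Rightarrow> 'b"
    and n l :: nat
    and E W :: "nat \<Rightarrow> 'b set"
  assumes "n \<ge> 1" and "l \<ge> 1"
    and "vector_space scale"
    and "vector_space.dim scale UNIV = l"
    and "\<And>i. i \<in> {1..n} \<Longrightarrow> module.subspace scale (W i)"
    and "\<And>i. i \<in> {1..n} \<Longrightarrow> vector_space.dim scale (W i) = 1"
    and "\<And>i. i \<in> {1..n} \<Longrightarrow> E i \<subseteq> W i"
  shows "matroid {1..n} {I. I \<subseteq> {1..n} \<and> vector_space.LISF scale I E}"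
proof -
  interpret vector_space scale
    by fact
  have "\<exists>w. W i \<subseteq> span {w}" if "i \<in> {1..n}" for i
    using dim_1_obtain_generator[OF assms(6)[OF that]] by blast
  then obtain w where "\<And>i. i \<in> {1..n} \<Longrightarrow> W i \<subseteq> span {w i}"
    by metis
  then have lines: "\<And>i. i \<in> {1..n} \<Longrightarrow> E i \<subseteq> span {w i}"
    using assms(7) by blast
  \<comment> \<open>Here \<open>l \<ge> 1\<close> enters: it excludes the value 0 that
    \<open>dim\<close> also takes on infinite-dimensional spaces.\<close>
  have "dim UNIV > 0"
    using assms(2,4) by simp
  then have "LISF I E \<longleftrightarrow> (\<forall>i\<in>I. E i \<noteq> {} \<and> 0 \<notin> E i) \<and> lin_indep_family I w"
    if "I \<subseteq> {1..n}" for I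
    using that lines by (intro LISF_lines_iff) blast+
  then have "{I. I \<subseteq> {1..n} \<and> LISF I E} =
      {I. I \<subseteq> {1..n} \<and> (\<forall>i\<in>I. E i \<noteq> {} \<and> 0 \<notin> E i) \<and> lin_indep_family I w}"
    by blast
  then show ?thesis
    using matroid_lin_indep_family[of "{1..n}" "\<lambda>i. E i \<noteq> {} \<and> 0 \<notin> E i" w] by simp
qed

end
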